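(* Let $(R,\oplus,\otimes)=(\mathbb{R},+,\times)$ and let all costs $c_\alpha$, $\alpha\in\Pi^\circ$, be strictly positive. Let $\Pi$ be the set of non-empty patterns that are both a prefix of some pattern in $\Pi^\circ$ and a suffix of some pattern in $\Pi^\circ$. For a pattern $\alpha=([i,j],\cdot)$ let $$\overrightarrow{W}_j(\alpha)=\sum_{x\in D^{1:j},\,x=\ast\alpha}f(x),\qquad \overleftarrow{W}_i(\alpha)=\sum_{y\in D^{i:n},\,y=\alpha\ast}f(y).$$ Consider the following algorithm. 1. For each $\alpha=([i,j],\cdot)\in\Pi$ set $$W(\alpha):=\frac{\overrightarrow{W}_j(\alpha)\,\overleftarrow{W}_i(\alpha)}{f(\alpha)},\qquad W^-(\alpha):=\frac{\overrightarrow{W}_{j-1}(\alpha_{i:j-1})\,\overleftarrow{W}_{i+1}(\alpha_{i+1:j})}{f(\alpha_{i+1:j-1})}.$$ 2. For $\alpha\in\Pi$, in the order of decreasing $|\alpha|$, set $$Z(\alpha):=W(\alpha)+\sum_{\beta\in\Phi(\alpha)}\big[Z(\beta)-W^-(\beta)\big].$$ Then the algorithm is correct, i.e. for every $\alpha\in\Pi$ the computed value satisfies $Z(\alpha)=\sum_{x\in\Omega(\alpha)}f(x)$, where $\Omega(\alpha)=\{x\in D^{1:n}\mid x=\ast\alpha\ast\}$.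
   Context: $D$ is a finite alphabet, $n\ge1$, and $\Gamma$ is a finite set of non-empty words over $D$. A pattern is a pair $\alpha=([i,j],w)$ where $[i,j]$ is an integer interval in $[1,n]$, possibly empty ($j\ge i-1$), and $w=w_i\ldots w_j$ is a word over $D$ of length $|\alpha|=j-i+1$. The concatenation of $([i,j],w)$ and $([j+1,k],v)$ is $([i,k],wv)$. The symbol $\ast$ denotes an arbitrary possibly empty pattern and $+$ an arbitrary non-empty pattern; e.g. $x=\ast\alpha\ast$ means that $\alpha$ is a subpattern of $x$ (at its own position), $x=\ast\alpha$ that $\alpha$ is a suffix of $x$, $x=\alpha\ast$ that $\alpha$ is a prefix of $x$. For $\alpha=([i,j],w)$ and $[k,\ell]\subseteq[i,j]$, $\alpha_{k:\ell}=([k,\ell],w_k\ldots w_\ell)$. $D^{i:j}$ is the set of patterns with interval $[i,j]$. $\Pi^\circ=\{([i,j],\alpha)\mid\alpha\in\Gamma,\ [i,j]\subseteq[1,n],\ j-i+1=|\alpha|\}$. The cost of a pattern $x$ is $f(x)=\prod_{\alpha\in\Pi^\circ,\,x=\ast\alpha\ast}c_\alpha$ (empty product $=1$). Write $\alpha\sqsubseteq\beta$ if $\beta=\ast\alpha\ast$, and $\alpha\sqsubset\beta$ if $\beta=+\alpha+$. For $\alpha\in\Pi$, $\Phi(\alpha)$ is the set of $\beta\in\Pi$ such that $\alpha\sqsubset\beta$ and there is no other pattern $\gamma\in\Pi$ (i.e. $\gamma\neq\beta$) with $\alpha\sqsubset\gamma\sqsubseteq\beta$. Elements of $\Phi(\alpha)$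 have length at least $3$, so $W^-$ is used only for patterns of length at least $3$; for $|\alpha|=1$ the denominator $f(\alpha_{i+1:j-1})$ is read as $1$. *)

theory Defs
  imports Complex_Main
begin

text \<open>
  The pair (i, w) stands for the pattern with word w on the interval [i, j], where
  j = i + length w - 1. Intervals are subintervals of [1, n], so i is at least 1, and the
  natural-number subtraction is exact also for the empty word (j = i - 1).
\<close>

type_synonym 'a pattern = "nat \<times> 'a list"

abbreviation pstart :: "'a pattern \<Rightarrow> nat" where
  "pstart \<alpha> \<equiv> fst \<alpha>"

abbreviation pword :: "'a pattern \<Rightarrow> 'a list" where
  "pword \<alpha> \<equiv> snd \<alpha>"

abbreviation plength :: "'a pattern \<Rightarrow> nat" where
  "plength \<alpha> \<equiv> length (pword \<alpha>)"

definition pend :: "'a pattern \<Rightarrow> nat" where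
  "pend \<alpha> = pstart \<alpha> + plength \<alpha> - 1"

text \<open>
  The relations below spell out the decompositions \<open>\<beta> = \<alpha>*\<close>, \<open>\<beta> = *\<alpha>\<close>, \<open>\<beta> = *\<alpha>*\<close> and
  \<open>\<beta> = +\<alpha>+\<close>: concatenation of patterns requires adjacent intervals, which fixes the
  start of \<alpha> relative to that of \<beta>.
\<close>

definition pprefix :: "'a pattern \<Rightarrow> 'a pattern \<Rightarrow> bool" where
  "pprefix \<alpha> \<beta> \<longleftrightarrow> pstart \<alpha> = pstart \<beta> \<and> (\<exists>v. pword \<beta> = pword \<alpha> @ v)"

definition psuffix :: "'a pattern \<Rightarrow> 'a pattern \<Rightarrow> bool" where
  "psuffix \<alpha> \<beta> \<longleftrightarrow>
     (\<exists>u. pword \<beta> = u @ pword \<alpha> \<and> pstart \<alpha> = pstart \<beta> + length u)"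

definition subpattern :: "'a pattern \<Rightarrow> 'a pattern \<Rightarrow> bool"  (infix "\<sqsubseteq>\<^sub>p" 50) where
  "\<alpha> \<sqsubseteq>\<^sub>p \<beta> \<longleftrightarrow>
     (\<exists>u v. pword \<beta> = u @ pword \<alpha> @ v \<and> pstart \<alpha> = pstart \<beta> + length u)"

definition inner_subpattern :: "'a pattern \<Rightarrow> 'a pattern \<Rightarrow> bool"  (infix "\<sqsubset>\<^sub>p" 50) where
  "\<alpha> \<sqsubset>\<^sub>p \<beta> \<longleftrightarrow>
     (\<exists>u v. u \<noteq> [] \<and> v \<noteq> [] \<and> pword \<beta> = u @ pword \<alpha> @ v
          \<and> pstart \<alpha> = pstart \<beta> + length u)"

text \<open>\<open>restrict \<alpha> k l\<close> is \<open>\<alpha>\<^sub>k\<^sub>:\<^sub>l\<close>; it is the empty pattern at k whenever l < k.\<close>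

definition restrict :: "'a pattern \<Rightarrow> nat \<Rightarrow> nat \<Rightarrow> 'a pattern" where
  "restrict \<alpha> k l = (k, take (l + 1 - k) (drop (k - pstart \<alpha>) (pword \<alpha>)))"

text \<open>\<open>patterns_on D i j\<close> is \<open>D\<^sup>i\<^sup>:\<^sup>j\<close>, for \<open>j \<ge> i - 1\<close>.\<close>

definition patterns_on :: "'a set \<Rightarrow> nat \<Rightarrow> nat \<Rightarrow> 'a pattern set" where
  "patterns_on D i j = {(i, w) | w. set w \<subseteq> D \<and> length w = j + 1 - i}"

definition Pi_circ :: "nat \<Rightarrow> 'a list set \<Rightarrow> 'a pattern set" where
  "Pi_circ n \<Gamma> = {(i, w) | i w. w \<in> \<Gamma> \<and> 1 \<le> i \<and> i + length w - 1 \<le> n}"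

definition Pi_set :: "nat \<Rightarrow> 'a list set \<Rightarrow> 'a pattern set" where
  "Pi_set n \<Gamma> = {\<alpha>. pword \<alpha> \<noteq> [] \<and> (\<exists>\<beta>\<in>Pi_circ n \<Gamma>. pprefix \<alpha> \<beta>)
                     \<and> (\<exists>\<beta>\<in>Pi_circ n \<Gamma>. psuffix \<alpha> \<beta>)}"

definition cost :: "nat \<Rightarrow> 'a list set \<Rightarrow> ('a pattern \<Rightarrow> real) \<Rightarrow> 'a pattern \<Rightarrow> real" where
  "cost n \<Gamma> c x = (\<Prod>\<alpha> | \<alpha> \<in> Pi_circ n \<Gamma> \<and> \<alpha> \<sqsubseteq>\<^sub>p x. c \<alpha>)"

definition Phi :: "nat \<Rightarrow> 'a list set \<Rightarrow> 'a pattern \<Rightarrow> 'a pattern set" where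
  "Phi n \<Gamma> \<alpha> = {\<beta> \<in> Pi_set n \<Gamma>. \<alpha> \<sqsubset>\<^sub>p \<beta> \<and>
                   \<not> (\<exists>\<gamma>\<in>Pi_set n \<Gamma>. \<gamma> \<noteq> \<beta> \<and> \<alpha> \<sqsubset>\<^sub>p \<gamma> \<and> \<gamma> \<sqsubseteq>\<^sub>p \<beta>)}"

definition Omega :: "nat \<Rightarrow> 'a set \<Rightarrow> 'a pattern \<Rightarrow> 'a pattern set" where
  "Omega n D \<alpha> = {x \<in> patterns_on D 1 n. \<alpha> \<sqsubseteq>\<^sub>p x}"

text \<open>
  The subscripts of the forward and backward sums are always the end and the start of the
  argument, so they are not separate parameters.
\<close>

definition W_fwd ::
    "nat \<Rightarrow> 'a set \<Rightarrow> 'a list set \<Rightarrow> ('a pattern \<Rightarrow> real) \<Rightarrow> 'a pattern \<Rightarrow> real" where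
  "W_fwd n D \<Gamma> c \<alpha> =
     (\<Sum>x | x \<in> patterns_on D 1 (pend \<alpha>) \<and> psuffix \<alpha> x. cost n \<Gamma> c x)"

definition W_bwd ::
    "nat \<Rightarrow> 'a set \<Rightarrow> 'a list set \<Rightarrow> ('a pattern \<Rightarrow> real) \<Rightarrow> 'a pattern \<Rightarrow> real" where
  "W_bwd n D \<Gamma> c \<alpha> =
     (\<Sum>y | y \<in> patterns_on D (pstart \<alpha>) n \<and> pprefix \<alpha> y. cost n \<Gamma> c y)"

definition W ::
    "nat \<Rightarrow> 'a set \<Rightarrow> 'a list set \<Rightarrow> ('a pattern \<Rightarrow> real) \<Rightarrow> 'a pattern \<Rightarrow> real" where
  "W n D \<Gamma> c \<alpha> = W_fwd n D \<Gamma> c \<alpha> * W_bwd n D \<Gamma> c \<alpha> / cost n \<Gamma> c \<alpha>"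

text \<open>
  If \<alpha> has length 1, the pattern in the denominator is an empty one, whose cost is 1 as long
  as \<Gamma> contains no empty word.
\<close>

definition W_minus ::
    "nat \<Rightarrow> 'a set \<Rightarrow> 'a list set \<Rightarrow> ('a pattern \<Rightarrow> real) \<Rightarrow> 'a pattern \<Rightarrow> real" where
  "W_minus n D \<Gamma> c \<alpha> = (let i = pstart \<alpha>; j = pend \<alpha> in
     W_fwd n D \<Gamma> c (restrict \<alpha> i (j - 1)) * W_bwd n D \<Gamma> c (restrict \<alpha> (i + 1) j)
       / cost n \<Gamma> c (restrict \<alpha> (i + 1) (j - 1)))"

text \<open>
  Step 2 of the algorithm is a loop of assignments to a table Z, visiting the patterns in the
  order of a list \<open>as\<close>. The initial contents \<open>Z\<^sub>0\<close> of the table is arbitrary, as is the order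
  among patterns of equal length.
\<close>

definition Z_step ::
    "nat \<Rightarrow> 'a set \<Rightarrow> 'a list set \<Rightarrow> ('a pattern \<Rightarrow> real)
      \<Rightarrow> 'a pattern \<Rightarrow> ('a pattern \<Rightarrow> real) \<Rightarrow> ('a pattern \<Rightarrow> real)" where
  "Z_step n D \<Gamma> c \<alpha> Z =
     Z(\<alpha> := W n D \<Gamma> c \<alpha> + (\<Sum>\<beta>\<in>Phi n \<Gamma> \<alpha>. Z \<beta> - W_minus n D \<Gamma> c \<beta>))"

definition Z_algorithm ::
    "nat \<Rightarrow> 'a set \<Rightarrow> 'a list set \<Rightarrow> ('a pattern \<Rightarrow> real)
      \<Rightarrow> 'a pattern list \<Rightarrow> ('a pattern \<Rightarrow> real) \<Rightarrow> ('a pattern \<Rightarrow> real)" where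
  "Z_algorithm n D \<Gamma> c as Z\<^sub>0 = fold (Z_step n D \<Gamma> c) as Z\<^sub>0"

definition decreasing_enumeration :: "'a pattern set \<Rightarrow> 'a pattern list \<Rightarrow> bool" where
  "decreasing_enumeration P as \<longleftrightarrow>
     distinct as \<and> set as = P \<and> sorted_wrt (\<lambda>\<alpha> \<beta>. plength \<alpha> \<ge> plength \<beta>) as"

lemma finite_Pi_set:
  assumes "finite \<Gamma>" and "[] \<notin> \<Gamma>"
  shows "finite (Pi_set n \<Gamma>)"
proof -
  have "Pi_circ n \<Gamma> \<subseteq> {..n} \<times> \<Gamma>"
  proof
    fix \<alpha> assume "\<alpha> \<in> Pi_circ n \<Gamma>"
    then obtain i w where iw: "\<alpha> = (i, w)" "w \<in> \<Gamma>" "i + length w - 1 \<le> n"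
      by (auto simp: Pi_circ_def)
    moreover have "length w > 0"
      using iw(2) assms(2) by auto
    ultimately have "i \<le> n"
      by linarith
    then show "\<alpha> \<in> {..n} \<times> \<Gamma>"
      using iw by simp
  qed
  then have fin: "finite (Pi_circ n \<Gamma>)"
    using assms(1) finite_subset by blast
  have "Pi_set n \<Gamma> \<subseteq> (\<Union>(i, w)\<in>Pi_circ n \<Gamma>. (\<lambda>k. (i, take k w)) ` {..length w})"
  proof
    fix \<alpha> assume "\<alpha> \<in> Pi_set n \<Gamma>"
    then obtain \<beta> v where "\<beta> \<in> Pi_circ n \<Gamma>" "pstart \<alpha> = pstart \<beta>" "pword \<beta> = pword \<alpha> @ v"
      by (auto simp: Pi_set_def pprefix_def)
    then show "\<alpha> \<in> (\<Union>(i, w)\<in>Pi_circ n \<Gamma>. (\<lambda>k. (i, take k w)) ` {..length w})"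
      by (intro UN_I[of \<beta>]) (auto simp: prod_eq_iff case_prod_beta intro!: image_eqI[of _ _ "plength \<alpha>"])
  qed
  then show ?thesis
    by (rule finite_subset) (use fin in auto)
qed

lemma decreasing_enumeration_exists:
  assumes "finite P"
  shows "\<exists>as. decreasing_enumeration P as"
proof -
  obtain xs where "set xs = P" "distinct xs"
    using assms finite_distinct_list by blast
  then have "decreasing_enumeration P (rev (sort_key plength xs))"
    using sorted_sort_key[of plength xs]
    by (auto simp: decreasing_enumeration_def sorted_wrt_rev sorted_wrt_map)
  then show ?thesis ..
qed

end

theory Submission
  imports Defs
begin

text \<open>
  For \<open>x \<in> \<Omega>(\<alpha>)\<close> let \<open>g(x)\<close> be the product of the costs of the occurrences in \<open>x\<close> that do not
  strictly surround \<alpha>. Glueing words along \<alpha> shows that \<open>W(\<alpha>)\<close> is the sum of \<open>g\<close> over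
  \<open>\<Omega>(\<alpha>)\<close>; likewise \<open>W\<^sup>-(\<beta>)\<close> sums the product of the costs of the occurrences that do not contain
  \<beta>. For fixed \<open>x\<close>, the patterns \<open>\<gamma> \<in> \<Pi>\<close> with \<open>\<alpha> \<sqsubset> \<gamma> \<sqsubseteq> x\<close> are closed under intersection,
  so either there are none and \<open>f(x) = g(x)\<close>, or there is a least one \<beta>, which is the only
  element of \<open>\<Phi>(\<alpha>)\<close> occurring in \<open>x\<close>. In the latter case the occurrences surrounding \<alpha>
  are exactly those containing \<beta>, so \<open>g(x)\<close> is the contribution of \<open>x\<close> to \<open>W\<^sup>-(\<beta>)\<close>.
\<close>

section \<open>Subpatterns\<close>

text \<open>Half-open counterpart of \<open>pend\<close>, one past the last position: it keeps the
  interval arithmetic free of truncated subtraction, also for empty patterns.\<close>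

abbreviation pstop :: "'a pattern \<Rightarrow> nat" where
  "pstop \<alpha> \<equiv> pstart \<alpha> + plength \<alpha>"

lemma subpattern_refl: "\<alpha> \<sqsubseteq>\<^sub>p \<alpha>"
  by (auto simp: subpattern_def)

lemma subpattern_trans: "\<alpha> \<sqsubseteq>\<^sub>p \<beta> \<Longrightarrow> \<beta> \<sqsubseteq>\<^sub>p \<gamma> \<Longrightarrow> \<alpha> \<sqsubseteq>\<^sub>p \<gamma>"
  unfolding subpattern_def
  by (metis add.assoc append.assoc length_append)

lemma subpattern_bounds:
  assumes "\<alpha> \<sqsubseteq>\<^sub>p \<beta>"
  shows "pstart \<beta> \<le> pstart \<alpha>" "pstop \<alpha> \<le> pstop \<beta>"
  using assms by (auto simp: subpattern_def)

lemma subpattern_eqI: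
  assumes "\<alpha> \<sqsubseteq>\<^sub>p \<beta>" "plength \<beta> \<le> plength \<alpha>"
  shows "\<alpha> = \<beta>"
  using assms by (auto simp: subpattern_def prod_eq_iff)

text \<open>Trades the existential words for two bounds and one slice equation, so that later facts
  about occurrences reduce to arithmetic and \<open>take\<close>/\<open>drop\<close>
  rewriting.\<close>

lemma subpattern_iff_take_drop:
  "\<alpha> \<sqsubseteq>\<^sub>p \<beta> \<longleftrightarrow> pstart \<beta> \<le> pstart \<alpha> \<and> pstop \<alpha> \<le> pstop \<beta> \<and>
     pword \<alpha> = take (plength \<alpha>) (drop (pstart \<alpha> - pstart \<beta>) (pword \<beta>))"
    (is "?L \<longleftrightarrow> ?R")
proof
  assume ?L
  then show ?R by (auto simp: subpattern_def)
next
  assume R: ?R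
  let ?d = "pstart \<alpha> - pstart \<beta>"
  have "pword \<beta> = take ?d (pword \<beta>) @ pword \<alpha> @ drop (plength \<alpha>) (drop ?d (pword \<beta>))"
    by (metis R append_take_drop_id)
  moreover have "pstart \<alpha> = pstart \<beta> + length (take ?d (pword \<beta>))"
    using R by auto
  ultimately show ?L
    unfolding subpattern_def by blast
qed

text \<open>Both words are slices of the single word of \<open>x\<close>, so they agree wherever
  their intervals overlap, and inclusion of intervals suffices.\<close>

lemma subpattern_within:
  assumes "\<alpha> \<sqsubseteq>\<^sub>p x" "\<beta> \<sqsubseteq>\<^sub>p x" "pstart \<beta> \<le> pstart \<alpha>" "pstop \<alpha> \<le> pstop \<beta>"
  shows "\<alpha> \<sqsubseteq>\<^sub>p \<beta>"
proof -
  let ?w = "pword x"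
  have a: "pword \<alpha> = take (plength \<alpha>) (drop (pstart \<alpha> - pstart x) ?w)"
    and b: "pword \<beta> = take (plength \<beta>) (drop (pstart \<beta> - pstart x) ?w)"
    and le: "pstart x \<le> pstart \<beta>"
    using assms(1,2) by (simp_all add: subpattern_iff_take_drop)
  have "take (plength \<alpha>) (drop (pstart \<alpha> - pstart \<beta>) (pword \<beta>))
      = take (plength \<alpha>) (drop (pstart \<alpha> - pstart x) ?w)"
    using assms(3,4) le by (subst b) (simp add: drop_take min_absorb1)
  with a assms(3,4) show ?thesis
    by (simp add: subpattern_iff_take_drop)
qed

lemma subpattern_on_interval_exists:
  assumes "pstart x \<le> i" "i \<le> k" "k \<le> pstop x"
  shows "\<exists>\<delta>. \<delta> \<sqsubseteq>\<^sub>p x \<and> pstart \<delta> = i \<and> pstop \<delta> = k"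
  using assms
  by (intro exI[of _ "(i, take (k - i) (drop (i - pstart x) (pword x)))"])
     (auto simp: subpattern_iff_take_drop)

lemma inner_subpattern_iff:
  "\<alpha> \<sqsubset>\<^sub>p \<beta> \<longleftrightarrow> \<alpha> \<sqsubseteq>\<^sub>p \<beta> \<and> pstart \<beta> < pstart \<alpha> \<and> pstop \<alpha> < pstop \<beta>"
  unfolding inner_subpattern_def subpattern_def
  by (auto simp flip: length_greater_0_conv)

lemma pprefix_iff: "pprefix \<alpha> \<beta> \<longleftrightarrow> \<alpha> \<sqsubseteq>\<^sub>p \<beta> \<and> pstart \<alpha> = pstart \<beta>"
  by (auto simp: pprefix_def subpattern_def)

lemma psuffix_iff: "psuffix \<alpha> \<beta> \<longleftrightarrow> \<alpha> \<sqsubseteq>\<^sub>p \<beta> \<and> pstop \<alpha> = pstop \<beta>"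
proof
  assume "psuffix \<alpha> \<beta>"
  then obtain u where "pword \<beta> = u @ pword \<alpha> @ []" "pstart \<alpha> = pstart \<beta> + length u"
    by (auto simp: psuffix_def)
  then show "\<alpha> \<sqsubseteq>\<^sub>p \<beta> \<and> pstop \<alpha> = pstop \<beta>"
    unfolding subpattern_def by (metis add.assoc append_Nil2 length_append)
qed (auto simp: psuffix_def subpattern_def)

text \<open>With its mirror image below, this lets all occurrence sets be compared inside one long
  word: passing to a piece only bounds one end of the occurrence.\<close>

lemma subpattern_append_left:
  "\<gamma> \<sqsubseteq>\<^sub>p (k, u) \<longleftrightarrow> \<gamma> \<sqsubseteq>\<^sub>p (k, u @ v) \<and> pstop \<gamma> \<le> k + length u"
  by (auto simp: subpattern_iff_take_drop)

lemma subpattern_append_right: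
  "\<gamma> \<sqsubseteq>\<^sub>p (k + length u, v) \<longleftrightarrow> \<gamma> \<sqsubseteq>\<^sub>p (k, u @ v) \<and> k + length u \<le> pstart \<gamma>"
  by (auto simp: subpattern_iff_take_drop diff_diff_add)

section \<open>The pattern set\<close>

lemma Pi_circ_subset_Pi_set:
  assumes "[] \<notin> \<Gamma>"
  shows "Pi_circ n \<Gamma> \<subseteq> Pi_set n \<Gamma>"
proof
  fix \<alpha> assume \<alpha>: "\<alpha> \<in> Pi_circ n \<Gamma>"
  then have "pword \<alpha> \<noteq> []"
    using assms by (auto simp: Pi_circ_def)
  with \<alpha> show "\<alpha> \<in> Pi_set n \<Gamma>"
    using subpattern_refl unfolding Pi_set_def pprefix_iff psuffix_iff by blast
qed

lemma finite_Pi_circ: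
  assumes "finite \<Gamma>" "[] \<notin> \<Gamma>"
  shows "finite (Pi_circ n \<Gamma>)"
  using finite_subset[OF Pi_circ_subset_Pi_set[OF assms(2)] finite_Pi_set[OF assms]] .

text \<open>The start is shared with the pattern of \<open>Pi_circ\<close> that has \<alpha> as a
  prefix, the end with the one that has \<alpha> as a suffix.\<close>

lemma Pi_set_bounds:
  assumes "\<alpha> \<in> Pi_set n \<Gamma>"
  shows "1 \<le> pstart \<alpha>" "pstop \<alpha> \<le> Suc n"
proof -
  obtain \<beta> \<gamma> where "\<beta> \<in> Pi_circ n \<Gamma>" "pstart \<alpha> = pstart \<beta>"
    and "\<gamma> \<in> Pi_circ n \<Gamma>" "pstop \<alpha> = pstop \<gamma>"
    using assms unfolding Pi_set_def pprefix_iff psuffix_iff by blast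
  then show "1 \<le> pstart \<alpha>" "pstop \<alpha> \<le> Suc n"
    by (auto simp: Pi_circ_def)
qed

lemma Pi_set_word:
  assumes "\<alpha> \<in> Pi_set n \<Gamma>" "\<Gamma> \<subseteq> lists D"
  shows "set (pword \<alpha>) \<subseteq> D"
proof -
  obtain \<beta> v where "\<beta> \<in> Pi_circ n \<Gamma>" "pword \<beta> = pword \<alpha> @ v"
    using assms(1) unfolding Pi_set_def pprefix_def by blast
  then have "pword \<alpha> @ v \<in> lists D"
    using assms(2) by (auto simp: Pi_circ_def)
  then show ?thesis by auto
qed

text \<open>The start of an intersection is the start of one pattern, and its end is the end of one.\<close>

lemma Pi_set_intersection:
  assumes \<beta>: "\<beta> \<in> Pi_set n \<Gamma>" and \<gamma>: "\<gamma> \<in> Pi_set n \<Gamma>"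
    and "\<delta> \<sqsubseteq>\<^sub>p \<beta>" "\<delta> \<sqsubseteq>\<^sub>p \<gamma>" "pword \<delta> \<noteq> []"
    and "pstart \<delta> = max (pstart \<beta>) (pstart \<gamma>)" "pstop \<delta> = min (pstop \<beta>) (pstop \<gamma>)"
  shows "\<delta> \<in> Pi_set n \<Gamma>"
proof -
  have "pprefix \<delta> \<beta> \<or> pprefix \<delta> \<gamma>" "psuffix \<delta> \<beta> \<or> psuffix \<delta> \<gamma>"
    using assms(3-) by (auto simp: pprefix_iff psuffix_iff max_def min_def)
  moreover have "pprefix \<delta> \<zeta>" if "pprefix \<delta> \<epsilon>" "pprefix \<epsilon> \<zeta>" for \<epsilon> \<zeta>
    using that by (auto simp: pprefix_iff intro: subpattern_trans)
  moreover have "psuffix \<delta> \<zeta>" if "psuffix \<delta> \<epsilon>" "psuffix \<epsilon> \<zeta>" for \<epsilon> \<zeta>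
    using that by (auto simp: psuffix_iff intro: subpattern_trans)
  ultimately show ?thesis
    using \<beta> \<gamma> assms(5) unfolding Pi_set_def by blast
qed

text \<open>A shortest candidate \<beta> is least: its intersection with any other candidate is
  again a candidate, hence no shorter than \<beta>, hence equal to \<beta>.\<close>

lemma least_surrounding_pattern:
  assumes "\<alpha> \<sqsubset>\<^sub>p \<gamma>\<^sub>0" "\<gamma>\<^sub>0 \<sqsubseteq>\<^sub>p x" "\<gamma>\<^sub>0 \<in> Pi_set n \<Gamma>" "pword \<alpha> \<noteq> []"
  obtains \<beta> where "\<beta> \<in> Pi_set n \<Gamma>" "\<alpha> \<sqsubset>\<^sub>p \<beta>" "\<beta> \<sqsubseteq>\<^sub>p x"
    and "\<And>\<gamma>. \<gamma> \<in> Pi_set n \<Gamma> \<Longrightarrow> \<alpha> \<sqsubset>\<^sub>p \<gamma> \<Longrightarrow> \<gamma> \<sqsubseteq>\<^sub>p x \<Longrightarrow> \<beta> \<sqsubseteq>\<^sub>p \<gamma>"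
proof -
  let ?P = "\<lambda>\<gamma>. \<gamma> \<in> Pi_set n \<Gamma> \<and> \<alpha> \<sqsubset>\<^sub>p \<gamma> \<and> \<gamma> \<sqsubseteq>\<^sub>p x"
  obtain \<beta> where \<beta>: "?P \<beta>" and least: "\<And>\<gamma>. ?P \<gamma> \<Longrightarrow> plength \<beta> \<le> plength \<gamma>"
    using ex_has_least_nat[of ?P \<gamma>\<^sub>0 plength] assms(1-3) by blast
  have "\<beta> \<sqsubseteq>\<^sub>p \<gamma>" if \<gamma>: "?P \<gamma>" for \<gamma>
  proof -
    let ?i = "max (pstart \<beta>) (pstart \<gamma>)" and ?k = "min (pstop \<beta>) (pstop \<gamma>)"
    \<comment> \<open>Strictness on both sides makes the intersection non-empty and lets it still
      surround \<alpha>.\<close>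
    have i: "?i < pstart \<alpha>" and k: "pstop \<alpha> < ?k"
      using \<beta> \<gamma> by (auto simp: inner_subpattern_iff)
    have "pstart x \<le> ?i" "?k \<le> pstop x"
      using subpattern_bounds[of \<beta> x] subpattern_bounds[of \<gamma> x] \<beta> \<gamma> by auto
    then obtain \<delta> where \<delta>: "\<delta> \<sqsubseteq>\<^sub>p x" "pstart \<delta> = ?i" "pstop \<delta> = ?k"
      using subpattern_on_interval_exists[of x ?i ?k] i k by auto
    have sub: "\<delta> \<sqsubseteq>\<^sub>p \<beta>" "\<delta> \<sqsubseteq>\<^sub>p \<gamma>"
      using \<beta> \<gamma> \<delta> by (auto intro: subpattern_within[of _ x])
    have "pword \<delta> \<noteq> []"
      using \<delta>(2,3) i k by auto
    then have "\<delta> \<in> Pi_set n \<Gamma>"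
      using Pi_set_intersection[of \<beta> n \<Gamma> \<gamma> \<delta>] \<beta> \<gamma> sub \<delta>(2,3) by blast
    moreover have "\<alpha> \<sqsubseteq>\<^sub>p x"
      using \<beta> by (auto simp: inner_subpattern_iff intro: subpattern_trans)
    then have "\<alpha> \<sqsubset>\<^sub>p \<delta>"
      using subpattern_within[of \<alpha> x \<delta>] \<delta> i k by (auto simp: inner_subpattern_iff)
    ultimately have "plength \<beta> \<le> plength \<delta>"
      using least \<delta>(1) by blast
    then show ?thesis
      using subpattern_eqI[OF sub(1)] sub(2) by simp
  qed
  then show ?thesis using that \<beta> by blast
qed

section \<open>Sums over glued words\<close>

definition words :: "'a set \<Rightarrow> nat \<Rightarrow> 'a list set" where
  "words D k = {w. set w \<subseteq> D \<and> length w = k}"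

text \<open>Only the word to the left of \<open>v\<close> is free; \<open>1 \<le> s\<close> makes
  its length \<open>s - 1\<close> exact.\<close>

lemma W_fwd_eq:
  assumes "1 \<le> s" "set v \<subseteq> D"
  shows "W_fwd n D \<Gamma> c (s, v) = (\<Sum>a\<in>words D (s - 1). cost n \<Gamma> c (1, a @ v))"
proof -
  have "{x. x \<in> patterns_on D 1 (pend (s, v)) \<and> psuffix (s, v) x}
      = (\<lambda>a. (1, a @ v)) ` words D (s - 1)"
    using assms by (auto simp: patterns_on_def psuffix_def pend_def words_def)
  moreover have "inj_on (\<lambda>a. (1::nat, a @ v)) (words D (s - 1))"
    by (auto simp: inj_on_def)
  ultimately show ?thesis
    unfolding W_fwd_def by (simp add: sum.reindex)
qed

lemma W_bwd_eq:
  assumes "i + length v \<le> Suc n" "set v \<subseteq> D"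
  shows "W_bwd n D \<Gamma> c (i, v) = (\<Sum>b\<in>words D (Suc n - (i + length v)). cost n \<Gamma> c (i, v @ b))"
proof -
  have "{y. y \<in> patterns_on D (pstart (i, v)) n \<and> pprefix (i, v) y}
      = (\<lambda>b. (i, v @ b)) ` words D (Suc n - (i + length v))"
    using assms by (auto simp: patterns_on_def pprefix_def words_def)
  moreover have "inj_on (\<lambda>b. (i, v @ b)) (words D (Suc n - (i + length v)))"
    by (auto simp: inj_on_def)
  ultimately show ?thesis
    unfolding W_bwd_def by (simp add: sum.reindex)
qed

lemma sum_Omega_eq:
  assumes "1 \<le> s" "s + length u \<le> Suc n" "set u \<subseteq> D"
  shows "sum g (Omega n D (s, u))
    = (\<Sum>a\<in>words D (s - 1). \<Sum>b\<in>words D (Suc n - (s + length u)). g (1, a @ u @ b))"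
proof -
  let ?A = "words D (s - 1)" and ?B = "words D (Suc n - (s + length u))"
  have "Omega n D (s, u) = (\<lambda>(a, b). (1::nat, a @ u @ b)) ` (?A \<times> ?B)"
  proof (intro equalityI subsetI)
    fix x assume "x \<in> Omega n D (s, u)"
    then obtain a b where "x = (1, a @ u @ b)" "s = 1 + length a"
      "set (a @ u @ b) \<subseteq> D" "length (a @ u @ b) = n"
      by (auto simp: Omega_def patterns_on_def subpattern_def)
    then show "x \<in> (\<lambda>(a, b). (1::nat, a @ u @ b)) ` (?A \<times> ?B)"
      by (intro image_eqI[of _ _ "(a, b)"]) (auto simp: words_def)
  next
    fix x assume "x \<in> (\<lambda>(a, b). (1::nat, a @ u @ b)) ` (?A \<times> ?B)"
    then obtain a b where "x = (1, a @ u @ b)" "a \<in> ?A" "b \<in> ?B"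
      by auto
    then show "x \<in> Omega n D (s, u)"
      using assms by (auto simp: Omega_def patterns_on_def subpattern_def words_def)
  qed
  \<comment> \<open>The lengths fixed by \<open>words\<close> determine where the word is
    cut.\<close>
  moreover have "inj_on (\<lambda>(a, b). (1::nat, a @ u @ b)) (?A \<times> ?B)"
    by (auto simp: inj_on_def words_def)
  ultimately show ?thesis
    by (simp add: sum.reindex sum.cartesian_product case_prod_unfold)
qed

text \<open>Leaves out the occurrences that exceed the half-open interval [i, k) on both sides. For
  the interval of \<alpha> these are the ones strictly surrounding \<alpha>; for the interval of
  \<beta> shrunk by one at each end, the ones containing \<beta>.\<close>

definition cost_outside ::
    "nat \<Rightarrow> 'a list set \<Rightarrow> ('a pattern \<Rightarrow> real) \<Rightarrow> nat \<Rightarrow> nat \<Rightarrow> 'a pattern \<Rightarrow> real" where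
  "cost_outside n \<Gamma> c i k x =
     (\<Prod>\<gamma> | \<gamma> \<in> Pi_circ n \<Gamma> \<and> \<gamma> \<sqsubseteq>\<^sub>p x \<and> (i \<le> pstart \<gamma> \<or> pstop \<gamma> \<le> k). c \<gamma>)"

text \<open>Inclusion-exclusion for products: the occurrences in the two overlapping pieces have as
  union those that do not exceed \<open>m\<close> on both sides, and as intersection those inside
  \<open>m\<close>.\<close>

lemma cost_glue:
  assumes "finite (Pi_circ n \<Gamma>)"
  shows "cost n \<Gamma> c (s, a @ m) * cost n \<Gamma> c (s + length a, m @ b)
    = cost n \<Gamma> c (s + length a, m)
      * cost_outside n \<Gamma> c (s + length a) (s + length a + length m) (s, a @ m @ b)"
proof -
  let ?S = "\<lambda>x. {\<gamma> \<in> Pi_circ n \<Gamma>. \<gamma> \<sqsubseteq>\<^sub>p x}" and ?i = "s + length a"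
  let ?L = "?S (s, a @ m)" and ?R = "?S (?i, m @ b)"
  have "\<gamma> \<sqsubseteq>\<^sub>p (s, a @ m) \<longleftrightarrow> \<gamma> \<sqsubseteq>\<^sub>p (s, a @ m @ b) \<and> pstop \<gamma> \<le> ?i + length m" for \<gamma>
    using subpattern_append_left[of \<gamma> s "a @ m" b] by (simp add: add.assoc)
  moreover have "\<gamma> \<sqsubseteq>\<^sub>p (?i, m @ b) \<longleftrightarrow> \<gamma> \<sqsubseteq>\<^sub>p (s, a @ m @ b) \<and> ?i \<le> pstart \<gamma>" for \<gamma>
    by (rule subpattern_append_right)
  moreover have "\<gamma> \<sqsubseteq>\<^sub>p (?i, m) \<longleftrightarrow> \<gamma> \<sqsubseteq>\<^sub>p (?i, m @ b) \<and> pstop \<gamma> \<le> ?i + length m" for \<gamma>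
    by (rule subpattern_append_left)
  ultimately have
    "{\<gamma> \<in> Pi_circ n \<Gamma>. \<gamma> \<sqsubseteq>\<^sub>p (s, a @ m @ b) \<and> (?i \<le> pstart \<gamma> \<or> pstop \<gamma> \<le> ?i + length m)}
      = ?L \<union> ?R"
    "?S (?i, m) = ?L \<inter> ?R"
    by blast+
  then show ?thesis
    using prod.union_inter[of ?L ?R c] assms
    by (simp add: cost_def cost_outside_def mult.commute)
qed

text \<open>Common form of both weights: empty \<open>p\<close> and \<open>q\<close> give
  \<open>W\<close>, single letters give \<open>W_minus\<close>. The product of the two sums runs
  over pairs of free words, and each pair glues to one element of \<open>Omega\<close>.\<close>

lemma W_product_eq:
  assumes "finite (Pi_circ n \<Gamma>)" "\<forall>\<alpha>\<in>Pi_circ n \<Gamma>. c \<alpha> > 0"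
    and "1 \<le> s" "s + length (p @ m @ q) \<le> Suc n" "set (p @ m @ q) \<subseteq> D"
  shows "W_fwd n D \<Gamma> c (s, p @ m) * W_bwd n D \<Gamma> c (s + length p, m @ q)
      / cost n \<Gamma> c (s + length p, m)
    = (\<Sum>x\<in>Omega n D (s, p @ m @ q).
        cost_outside n \<Gamma> c (s + length p) (s + length p + length m) x)"
proof -
  let ?i = "s + length p"
  let ?A = "words D (s - 1)" and ?B = "words D (Suc n - (s + length (p @ m @ q)))"
  have pos: "cost n \<Gamma> c (?i, m) > 0"
    unfolding cost_def using assms(2) by (intro prod_pos) auto
  have glue: "cost n \<Gamma> c (1, a @ p @ m) * cost n \<Gamma> c (?i, (m @ q) @ b) / cost n \<Gamma> c (?i, m)
      = cost_outside n \<Gamma> c ?i (?i + length m) (1, a @ (p @ m @ q) @ b)"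
    if "a \<in> ?A" for a b
  proof -
    \<comment> \<open>Since the glued word starts at 1, this places \<open>m\<close> at
      \<open>s + length p\<close>, where the right factor begins.\<close>
    have s: "s = Suc (length a)"
      using that assms(3) by (simp add: words_def)
    then show ?thesis
      using cost_glue[OF assms(1), of c 1 "a @ p" m "q @ b"] pos
      by (simp add: s mult.commute)
  qed
  have "W_bwd n D \<Gamma> c (?i, m @ q) = (\<Sum>b\<in>?B. cost n \<Gamma> c (?i, (m @ q) @ b))"
    using assms(4,5) by (subst W_bwd_eq) (auto simp: add.assoc)
  moreover have "W_fwd n D \<Gamma> c (s, p @ m) = (\<Sum>a\<in>?A. cost n \<Gamma> c (1, a @ p @ m))"
    using assms(3,5) by (subst W_fwd_eq) auto
  ultimately have "W_fwd n D \<Gamma> c (s, p @ m) * W_bwd n D \<Gamma> c (?i, m @ q) / cost n \<Gamma> c (?i, m)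
    = (\<Sum>a\<in>?A. \<Sum>b\<in>?B.
        cost n \<Gamma> c (1, a @ p @ m) * cost n \<Gamma> c (?i, (m @ q) @ b) / cost n \<Gamma> c (?i, m))"
    by (simp add: sum_product sum_divide_distrib)
  also have "\<dots> = (\<Sum>a\<in>?A. \<Sum>b\<in>?B.
      cost_outside n \<Gamma> c ?i (?i + length m) (1, a @ (p @ m @ q) @ b))"
    using glue by (intro sum.cong) auto
  finally show ?thesis
    by (simp only: sum_Omega_eq[OF assms(3-5)])
qed

lemma W_eq:
  assumes "finite (Pi_circ n \<Gamma>)" "\<forall>\<alpha>\<in>Pi_circ n \<Gamma>. c \<alpha> > 0"
    and "1 \<le> pstart \<alpha>" "pstop \<alpha> \<le> Suc n" "set (pword \<alpha>) \<subseteq> D"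
  shows "W n D \<Gamma> c \<alpha> = (\<Sum>x\<in>Omega n D \<alpha>. cost_outside n \<Gamma> c (pstart \<alpha>) (pstop \<alpha>) x)"
  using W_product_eq[OF assms(1,2), of "pstart \<alpha>" "[]" "pword \<alpha>" "[]" D] assms(3-)
  by (simp add: W_def)

lemma W_minus_eq:
  assumes "finite (Pi_circ n \<Gamma>)" "\<forall>\<alpha>\<in>Pi_circ n \<Gamma>. c \<alpha> > 0"
    and "1 \<le> pstart \<beta>" "pstop \<beta> \<le> Suc n" "set (pword \<beta>) \<subseteq> D" "2 \<le> plength \<beta>"
  shows "W_minus n D \<Gamma> c \<beta>
    = (\<Sum>x\<in>Omega n D \<beta>. cost_outside n \<Gamma> c (pstart \<beta> + 1) (pstop \<beta> - 1) x)"
proof -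
  obtain s u where su: "\<beta> = (s, u)" by (cases \<beta>)
  have "2 \<le> length u" using assms(6) su by simp
  \<comment> \<open>The first and last letters play the roles of \<open>p\<close> and
    \<open>q\<close>; \<open>m\<close> may be empty.\<close>
  then obtain h m l where u: "u = [h] @ m @ [l]"
    by (cases u; cases "tl u" rule: rev_cases) auto
  have "restrict \<beta> (pstart \<beta>) (pend \<beta> - 1) = (s, [h] @ m)"
    "restrict \<beta> (pstart \<beta> + 1) (pend \<beta>) = (s + length [h], m @ [l])"
    "restrict \<beta> (pstart \<beta> + 1) (pend \<beta> - 1) = (s + length [h], m)"
    using assms(3) by (auto simp: su u restrict_def pend_def)
  then show ?thesis
    using W_product_eq[OF assms(1,2), of s "[h]" m "[l]" D] assms(3-5)
    by (simp add: W_minus_def su u)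
qed

section \<open>The recursion\<close>

text \<open>The recursion for a single \<open>x\<close>: the sum has at most one term. With no
  surrounding pattern in \<open>x\<close> it is empty; otherwise only the least one contributes, and
  the two outside costs cancel.\<close>

lemma cost_decomposition:
  assumes "finite \<Gamma>" "[] \<notin> \<Gamma>" "\<alpha> \<sqsubseteq>\<^sub>p x" "pword \<alpha> \<noteq> []"
  shows "cost n \<Gamma> c x = cost_outside n \<Gamma> c (pstart \<alpha>) (pstop \<alpha>) x
    + (\<Sum>\<beta> | \<beta> \<in> Phi n \<Gamma> \<alpha> \<and> \<beta> \<sqsubseteq>\<^sub>p x.
        cost n \<Gamma> c x - cost_outside n \<Gamma> c (pstart \<beta> + 1) (pstop \<beta> - 1) x)"
proof -
  \<comment> \<open>Every factor missing from the outside cost of \<alpha> belongs to a surrounding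
    member of \<open>Pi_set\<close>, so the case split and leastness apply to it.\<close>
  have surround: "\<gamma> \<in> Pi_set n \<Gamma>" "\<alpha> \<sqsubset>\<^sub>p \<gamma>"
    if "\<gamma> \<in> Pi_circ n \<Gamma>" "\<gamma> \<sqsubseteq>\<^sub>p x" "\<not> (pstart \<alpha> \<le> pstart \<gamma> \<or> pstop \<gamma> \<le> pstop \<alpha>)" for \<gamma>
    using that assms(3) subpattern_within[of \<alpha> x \<gamma>] Pi_circ_subset_Pi_set[OF assms(2)]
    by (auto simp: inner_subpattern_iff)
  show ?thesis
  proof (cases "\<exists>\<gamma>\<in>Pi_set n \<Gamma>. \<alpha> \<sqsubset>\<^sub>p \<gamma> \<and> \<gamma> \<sqsubseteq>\<^sub>p x")
    case False
    then have "{\<beta>. \<beta> \<in> Phi n \<Gamma> \<alpha> \<and> \<beta> \<sqsubseteq>\<^sub>p x} = {}"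
      by (auto simp: Phi_def)
    moreover have "cost n \<Gamma> c x = cost_outside n \<Gamma> c (pstart \<alpha>) (pstop \<alpha>) x"
      unfolding cost_def cost_outside_def
      using False surround by (intro prod.cong) blast+
    ultimately show ?thesis by (simp only: sum.empty add_0_right)
  next
    case True
    then obtain \<beta> where \<beta>: "\<beta> \<in> Pi_set n \<Gamma>" "\<alpha> \<sqsubset>\<^sub>p \<beta>" "\<beta> \<sqsubseteq>\<^sub>p x"
      and least: "\<And>\<gamma>. \<gamma> \<in> Pi_set n \<Gamma> \<Longrightarrow> \<alpha> \<sqsubset>\<^sub>p \<gamma> \<Longrightarrow> \<gamma> \<sqsubseteq>\<^sub>p x \<Longrightarrow> \<beta> \<sqsubseteq>\<^sub>p \<gamma>"
      using least_surrounding_pattern assms(4) by metis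
    have bounds: "pstart \<beta> < pstart \<alpha>" "pstop \<alpha> < pstop \<beta>"
      using \<beta>(2) by (auto simp: inner_subpattern_iff)
    have "\<gamma> = \<beta>" if "\<gamma> \<in> Pi_set n \<Gamma>" "\<alpha> \<sqsubset>\<^sub>p \<gamma>" "\<gamma> \<sqsubseteq>\<^sub>p \<beta>" for \<gamma>
      using least[OF that(1,2)] subpattern_trans[OF that(3) \<beta>(3)] that(3)
        subpattern_bounds[of \<beta> \<gamma>] subpattern_bounds[of \<gamma> \<beta>]
      by (intro subpattern_eqI) auto
    then have "\<beta> \<in> Phi n \<Gamma> \<alpha>"
      using \<beta> by (auto simp: Phi_def)
    \<comment> \<open>By leastness \<beta> lies in \<beta>', so if they differed \<beta> would be
      the intermediate pattern that \<open>Phi\<close> forbids.\<close>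
    moreover have "\<beta>' = \<beta>" if "\<beta>' \<in> Phi n \<Gamma> \<alpha>" "\<beta>' \<sqsubseteq>\<^sub>p x" for \<beta>'
      using that least[of \<beta>'] \<beta> by (auto simp: Phi_def)
    ultimately have "{\<beta>'. \<beta>' \<in> Phi n \<Gamma> \<alpha> \<and> \<beta>' \<sqsubseteq>\<^sub>p x} = {\<beta>}"
      using \<beta>(3) by blast
    \<comment> \<open>In negated form: an occurrence surrounds \<alpha> exactly when it contains
      \<beta>. Leastness of \<beta> gives one direction, the bounds the other.\<close>
    moreover have "pstart \<alpha> \<le> pstart \<gamma> \<or> pstop \<gamma> \<le> pstop \<alpha> \<longleftrightarrow>
        pstart \<beta> + 1 \<le> pstart \<gamma> \<or> pstop \<gamma> \<le> pstop \<beta> - 1"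
      if "\<gamma> \<in> Pi_circ n \<Gamma>" "\<gamma> \<sqsubseteq>\<^sub>p x" for \<gamma>
    proof
      assume "pstart \<beta> + 1 \<le> pstart \<gamma> \<or> pstop \<gamma> \<le> pstop \<beta> - 1"
      then have "\<not> \<beta> \<sqsubseteq>\<^sub>p \<gamma>"
        using subpattern_bounds[of \<beta> \<gamma>] bounds by auto
      then show "pstart \<alpha> \<le> pstart \<gamma> \<or> pstop \<gamma> \<le> pstop \<alpha>"
        using least surround[OF that] that(2) by blast
    qed (use bounds in auto)
    then have "cost_outside n \<Gamma> c (pstart \<alpha>) (pstop \<alpha>) x
        = cost_outside n \<Gamma> c (pstart \<beta> + 1) (pstop \<beta> - 1) x"
      unfolding cost_outside_def by (intro prod.cong) blast+
    ultimately show ?thesis by simp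
  qed
qed

lemma finite_Omega:
  assumes "finite D"
  shows "finite (Omega n D \<alpha>)"
proof (rule finite_subset)
  show "Omega n D \<alpha> \<subseteq> {1} \<times> {w. set w \<subseteq> D \<and> length w = n}"
    by (auto simp: Omega_def patterns_on_def)
  show "finite ({1::nat} \<times> {w. set w \<subseteq> D \<and> length w = n})"
    using finite_lists_length_eq[OF assms] by simp
qed

text \<open>Sum the identity for single words over \<open>Omega n D \<alpha>\<close> and exchange
  the sums; the words left for each \<beta> are exactly those of
  \<open>Omega n D \<beta>\<close>.\<close>

lemma sum_cost_recursion:
  assumes "finite D" "finite \<Gamma>" "\<Gamma> \<subseteq> lists D" "[] \<notin> \<Gamma>" "\<forall>\<alpha>\<in>Pi_circ n \<Gamma>. c \<alpha> > 0"
    and \<alpha>: "\<alpha> \<in> Pi_set n \<Gamma>"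
  shows "(\<Sum>x\<in>Omega n D \<alpha>. cost n \<Gamma> c x) = W n D \<Gamma> c \<alpha>
    + (\<Sum>\<beta>\<in>Phi n \<Gamma> \<alpha>. (\<Sum>x\<in>Omega n D \<beta>. cost n \<Gamma> c x) - W_minus n D \<Gamma> c \<beta>)"
proof -
  let ?h = "\<lambda>\<beta> x. cost n \<Gamma> c x - cost_outside n \<Gamma> c (pstart \<beta> + 1) (pstop \<beta> - 1) x"
  note fin = finite_Pi_circ[OF assms(2,4), of n]
  have fin_Phi: "finite (Phi n \<Gamma> \<alpha>)"
    using finite_Pi_set[OF assms(2,4), of n] by (simp add: Phi_def)
  have ne: "pword \<alpha> \<noteq> []"
    using \<alpha> by (simp add: Pi_set_def)
  have *: "(\<Sum>x\<in>Omega n D \<beta>. cost n \<Gamma> c x) - W_minus n D \<Gamma> c \<beta>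
      = (\<Sum>x | x \<in> Omega n D \<alpha> \<and> \<beta> \<sqsubseteq>\<^sub>p x. ?h \<beta> x)" if "\<beta> \<in> Phi n \<Gamma> \<alpha>" for \<beta>
  proof -
    have \<beta>: "\<beta> \<in> Pi_set n \<Gamma>" "\<alpha> \<sqsubset>\<^sub>p \<beta>"
      using that by (auto simp: Phi_def)
    then have "\<alpha> \<sqsubseteq>\<^sub>p \<beta>" "2 \<le> plength \<beta>"
      using ne by (auto simp: inner_subpattern_iff)
    \<comment> \<open>Any word containing \<beta> also contains \<alpha>, by transitivity.\<close>
    then have "Omega n D \<beta> = {x. x \<in> Omega n D \<alpha> \<and> \<beta> \<sqsubseteq>\<^sub>p x}"
      by (auto simp: Omega_def intro: subpattern_trans)
    moreover have "W_minus n D \<Gamma> c \<beta>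
        = (\<Sum>x\<in>Omega n D \<beta>. cost_outside n \<Gamma> c (pstart \<beta> + 1) (pstop \<beta> - 1) x)"
      using Pi_set_bounds[OF \<beta>(1)] Pi_set_word[OF \<beta>(1) assms(3)] \<open>2 \<le> plength \<beta>\<close>
      by (intro W_minus_eq fin assms(5)) auto
    ultimately show ?thesis
      by (simp add: sum_subtractf)
  qed
  have "(\<Sum>x\<in>Omega n D \<alpha>. cost n \<Gamma> c x)
      = (\<Sum>x\<in>Omega n D \<alpha>. cost_outside n \<Gamma> c (pstart \<alpha>) (pstop \<alpha>) x
          + (\<Sum>\<beta> | \<beta> \<in> Phi n \<Gamma> \<alpha> \<and> \<beta> \<sqsubseteq>\<^sub>p x. ?h \<beta> x))"
    by (intro sum.cong refl cost_decomposition assms ne) (simp add: Omega_def)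
  also have "\<dots> = W n D \<Gamma> c \<alpha>
      + (\<Sum>x\<in>Omega n D \<alpha>. \<Sum>\<beta> | \<beta> \<in> Phi n \<Gamma> \<alpha> \<and> \<beta> \<sqsubseteq>\<^sub>p x. ?h \<beta> x)"
    using W_eq[OF fin assms(5) Pi_set_bounds[OF \<alpha>] Pi_set_word[OF \<alpha> assms(3)]]
    by (simp add: sum.distrib)
  also have "(\<Sum>x\<in>Omega n D \<alpha>. \<Sum>\<beta> | \<beta> \<in> Phi n \<Gamma> \<alpha> \<and> \<beta> \<sqsubseteq>\<^sub>p x. ?h \<beta> x)
      = (\<Sum>\<beta>\<in>Phi n \<Gamma> \<alpha>. \<Sum>x | x \<in> Omega n D \<alpha> \<and> \<beta> \<sqsubseteq>\<^sub>p x. ?h \<beta> x)"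
    by (rule sum.swap_restrict[OF finite_Omega[OF assms(1)] fin_Phi])
  also have "\<dots> = (\<Sum>\<beta>\<in>Phi n \<Gamma> \<alpha>. (\<Sum>x\<in>Omega n D \<beta>. cost n \<Gamma> c x) - W_minus n D \<Gamma> c \<beta>)"
    using * by simp
  finally show ?thesis .
qed

section \<open>From the recursion to the loop of assignments\<close>

text \<open>Any solution \<open>S\<close> of the recursion is what the loop computes: each
  assignment reads only entries already set, so the initial table does not matter. Removing the last
  pattern preserves closure under \<open>Phi\<close>, which drives the induction.\<close>

lemma fold_Z_step_eq:
  assumes "sorted_wrt (\<lambda>\<alpha> \<beta>. plength \<alpha> \<ge> plength \<beta>) as"
    and "\<And>\<alpha>. \<alpha> \<in> set as \<Longrightarrow> Phi n \<Gamma> \<alpha> \<subseteq> set as"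
    and "\<And>\<alpha>. \<alpha> \<in> set as \<Longrightarrow>
      S \<alpha> = W n D \<Gamma> c \<alpha> + (\<Sum>\<beta>\<in>Phi n \<Gamma> \<alpha>. S \<beta> - W_minus n D \<Gamma> c \<beta>)"
  shows "\<forall>\<alpha>\<in>set as. fold (Z_step n D \<Gamma> c) as Z \<alpha> = S \<alpha>"
  using assms
proof (induction as rule: rev_induct)
  case Nil
  then show ?case by simp
next
  case (snoc \<alpha> as)
  \<comment> \<open>Members of \<open>Phi n \<Gamma> \<alpha>'\<close> are strictly longer than
    \<alpha>', while the last pattern is a shortest one. The case of \<alpha>' equal to \<alpha> is
    included, so the last step does not read its own entry.\<close>
  have longer: "\<alpha> \<notin> Phi n \<Gamma> \<alpha>'" if "\<alpha>' \<in> set (as @ [\<alpha>])" for \<alpha>'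
  proof -
    have "plength \<alpha> \<le> plength \<alpha>'"
      using that snoc.prems(1) by (auto simp: sorted_wrt_append)
    then show ?thesis
      by (auto simp: Phi_def inner_subpattern_iff)
  qed
  have closed: "Phi n \<Gamma> \<alpha>' \<subseteq> set as" if "\<alpha>' \<in> set (as @ [\<alpha>])" for \<alpha>'
    using snoc.prems(2)[OF that] longer[OF that] by auto
  have IH: "\<forall>\<alpha>\<in>set as. fold (Z_step n D \<Gamma> c) as Z \<alpha> = S \<alpha>"
    using snoc.prems closed by (intro snoc.IH) (auto simp: sorted_wrt_append)
  have "(\<Sum>\<beta>\<in>Phi n \<Gamma> \<alpha>. fold (Z_step n D \<Gamma> c) as Z \<beta> - W_minus n D \<Gamma> c \<beta>)
      = (\<Sum>\<beta>\<in>Phi n \<Gamma> \<alpha>. S \<beta> - W_minus n D \<Gamma> c \<beta>)"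
    using closed[of \<alpha>] IH by (intro sum.cong) auto
  then show ?case
    using snoc.prems(3)[of \<alpha>] IH Z_step_def[of n D \<Gamma> c \<alpha>] by auto
qed

theorem theorem6:
  fixes n :: nat and D :: "'a set" and \<Gamma> :: "'a list set"
    and c :: "'a pattern \<Rightarrow> real"
    and as :: "'a pattern list" and Z\<^sub>0 :: "'a pattern \<Rightarrow> real"
  assumes "n \<ge> 1"
    and "finite D"
    and "finite \<Gamma>" and "\<Gamma> \<subseteq> lists D" and "[] \<notin> \<Gamma>"
    and "\<forall>\<alpha>\<in>Pi_circ n \<Gamma>. c \<alpha> > 0"
    and "decreasing_enumeration (Pi_set n \<Gamma>) as"
  shows "\<forall>\<alpha>\<in>Pi_set n \<Gamma>.
    Z_algorithm n D \<Gamma> c as Z\<^sub>0 \<alpha> = (\<Sum>x\<in>Omega n D \<alpha>. cost n \<Gamma> c x)"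
proof -
  have as: "set as = Pi_set n \<Gamma>" "sorted_wrt (\<lambda>\<alpha> \<beta>. plength \<alpha> \<ge> plength \<beta>) as"
    using assms(7) by (auto simp: decreasing_enumeration_def)
  have "\<forall>\<alpha>\<in>set as. fold (Z_step n D \<Gamma> c) as Z\<^sub>0 \<alpha> = (\<Sum>x\<in>Omega n D \<alpha>. cost n \<Gamma> c x)"
  \<comment> \<open>Here \<open>S\<close> is the true sum over \<open>Omega\<close>, which solves
    the recursion.\<close>
  proof (rule fold_Z_step_eq[OF as(2)])
    show "Phi n \<Gamma> \<alpha> \<subseteq> set as" for \<alpha>
      using as(1) by (auto simp: Phi_def)
  qed (use as(1) sum_cost_recursion[OF assms(2-6)] in blast)
  then show ?thesis
    by (simp add: Z_algorithm_def as(1))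
qed

end
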